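(* Let $\mu$ be a non-decreasing real-valued function on $[0,1]$ (equivalently, a finite positive Borel measure $d\mu$ on $[0,1]$), taking finitely many or infinitely many different values, and let $$f(\xi)=\int_0^1\frac{d\mu(z)}{1+z\xi},\qquad \xi\in\mathbb{C}\setminus(-\infty,-1].$$ Then for all integers $L,M$ with $L-M+1\ge 0$, $L\ne -1$ and $M\ge 0$, the poles (in the variable $\xi$) of the $[L/M]$ Padé approximant of $f$ are simple poles lying on $(-\infty,-1)$ with positive residues.
   Context: With $\mu_n:=\int_0^1 z^n\,d\mu(z)$, one has $f(\xi)=\sum_{n\ge 0}\mu_n(-\xi)^n$ for $|\xi|<1$. For integers $L,M\ge 0$, the $[L/M]$ Padé approximant of $f$ is the rational function (unique as a rational function when it exists) $$[L/M]_f(-\xi)=\frac{a_0+a_1(-\xi)+\cdots+a_L(-\xi)^L}{1+b_1(-\xi)+\cdots+b_M(-\xi)^M}$$ satisfying the accuracy-through-order property $f(\xi)-[L/M]_f(-\xi)=O(\xi^{L+M+1})$ as $\xi\to 0$. Leading coefficients are allowed to vanish. The paper establishes that this approximant exists for all $L,M$ with $L-M+1\ge 0$, $L\ne -1$, $M\ge 0$. Poles and residues are those of this rational function, as a function of $\xi$.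
   Formalization: The open ray (-∞,-1) is replaced by (-∞,-1] exactly when μ has an atom at 1 and so few atoms that f is itself rational of type [L/M]; there -1 is a pole (e.g. unit mass at 1, L=0, M=1: f=1/(1+ξ)), so the literal claim fails. All else is as stated. *)

theory Defs
  imports
    "HOL-Analysis.Analysis"
    "HOL-Complex_Analysis.Complex_Analysis"
    "HOL-Library.Landau_Symbols"
    "HOL-Computational_Algebra.Polynomial"
begin

definition borel_measure_on_unit_interval :: "real measure \<Rightarrow> bool" where
  "borel_measure_on_unit_interval \<mu> \<longleftrightarrow>
     finite_measure \<mu> \<and> sets \<mu> = sets (restrict_space borel {0..1})"

text \<open>The function f. As a total function it also has (meaningless) values on the cut from
  minus infinity to -1, where the integral may diverge; nothing below refers to them.\<close>

definition stieltjes_function :: "real measure \<Rightarrow> complex \<Rightarrow> complex" where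
  "stieltjes_function \<mu> \<xi> = (LINT z|\<mu>. 1 / (1 + complex_of_real z * \<xi>))"

text \<open>Numerator and denominator are polynomials in \<open>-\<xi>\<close>. They need not be coprime and their leading
  coefficients may vanish, so only upper bounds on the degrees are imposed. At a zero of the
  denominator \<open>R\<close> has the junk value 0; poles, pole orders and residues do not depend on it.\<close>

definition pade_approximant ::
    "(complex \<Rightarrow> complex) \<Rightarrow> nat \<Rightarrow> nat \<Rightarrow> (complex \<Rightarrow> complex) \<Rightarrow> bool" where
  "pade_approximant f L M R \<longleftrightarrow>
     (\<exists>P Q :: complex poly.
        degree P \<le> L \<and> degree Q \<le> M \<and> coeff Q 0 = 1 \<and>
        R = (\<lambda>\<xi>. poly P (-\<xi>) / poly Q (-\<xi>))) \<and>
     (\<lambda>\<xi>. f \<xi> - R \<xi>) \<in> O[at 0](\<lambda>\<xi>. \<xi> ^ (L + M + 1))"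

text \<open>The degenerate case: \<open>\<mu>\<close> consists of finitely many point masses, one of them at 1, so few that
  f is itself a rational function of type [L/M]. Then the approximant is f, and it has
  a pole at the end point -1. A point mass at 0 only adds a constant to f, which is absorbed by the
  numerator when \<open>M \<le> L\<close>. Example: the unit mass at 1 with L = 0 and M = 1, where
  f and its approximant are both \<open>1 / (1 + \<xi>)\<close>.\<close>

definition degenerate_with_atom_at_one :: "real measure \<Rightarrow> nat \<Rightarrow> nat \<Rightarrow> bool" where
  "degenerate_with_atom_at_one \<mu> L M \<longleftrightarrow>
     measure \<mu> {1} > 0 \<and>
     (\<exists>S. finite S \<and> card S \<le> M \<and> (AE z in \<mu>. z \<in> S \<or> (z = 0 \<and> M \<le> L)))"

end

theory Submission
  imports Defs
begin

text \<open>
  Write \<open>x = -\<xi>\<close>, let \<open>P / Q\<close> be the approximant in the variable \<open>x\<close> and put \<open>J = L - M + 1\<close>.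
  Accuracy through order says that the reversed denominator \<open>z^M Q(1/z)\<close> is orthogonal to all
  polynomials of degree less than \<open>M\<close> with respect to the positive measure \<open>z^J d\<mu>\<close>. After
  cancelling common factors, let \<open>x\<close> be a root of \<open>Q\<close>, so that the reversed denominator is
  \<open>(z - t) Q1(z)\<close> with \<open>t = 1 / x\<close>, and a telescoping sum gives \<open>P(x) = x^L \<integral> z^J Q1 d\<mu>\<close>.
  Testing orthogonality against the conjugate of \<open>Q1\<close> exhibits \<open>t\<close> as the mean of \<open>z\<close> for the
  weight \<open>z^J |Q1|^2 d\<mu>\<close>, which is nonzero since \<open>P(x) \<noteq> 0\<close>; hence \<open>0 < t \<le> 1\<close>, and \<open>t = 1\<close> forces
  this weight to be concentrated at 1. Testing against the difference quotient of the conjugate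
  of \<open>Q1\<close> at \<open>t\<close> shows that \<open>\<integral> z^J Q1 d\<mu>\<close> is a positive multiple of \<open>Q1(t)\<close>, so that the pole
  is simple and its residue is positive.
\<close>

section \<open>Moment functional and reversed polynomials\<close>

definition moment_functional :: "real measure \<Rightarrow> complex poly \<Rightarrow> complex" where
  "moment_functional \<mu> p = (LINT z|\<mu>. poly p (complex_of_real z))"

text \<open>The polynomial part of \<open>z^n q(1/z)\<close>; it is \<open>z^n q(1/z)\<close> itself once \<open>n \<ge> degree q\<close>. The
  moment functional maps it to the \<open>n\<close>-th Taylor coefficient, in \<open>x\<close>, of \<open>f\<close> times \<open>q\<close>.\<close>

primrec rev_trunc :: "'a::zero poly \<Rightarrow> nat \<Rightarrow> 'a poly" where
  "rev_trunc q 0 = [:coeff q 0:]"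
| "rev_trunc q (Suc n) = pCons (coeff q (Suc n)) (rev_trunc q n)"

lemma degree_rev_trunc: "degree (rev_trunc q n) \<le> n"
proof (induction n)
  case (Suc n)
  then show ?case
    using degree_pCons_le[of "coeff q (Suc n)" "rev_trunc q n"] by simp
qed simp

lemma rev_trunc_add:
  fixes q :: "'a::comm_semiring_1 poly"
  assumes "degree q \<le> M"
  shows "rev_trunc q (M + j) = monom 1 j * rev_trunc q M"
proof (induction j)
  case 0
  show ?case by (simp flip: one_pCons)
next
  case (Suc j)
  have "coeff q (Suc (M + j)) = 0"
    using assms by (intro coeff_eq_0) simp
  then show ?case
    using Suc by (simp add: monom_Suc)
qed

lemma poly_rev_trunc_inverse:
  fixes q :: "'a::comm_ring_1 poly"
  assumes "x * z = 1"
  shows "x ^ n * poly (rev_trunc q n) z = (\<Sum>i\<le>n. coeff q i * x ^ i)"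
proof (induction n)
  case (Suc n)
  have "x ^ Suc n * poly (rev_trunc q (Suc n)) z
      = coeff q (Suc n) * x ^ Suc n + (x * z) * (x ^ n * poly (rev_trunc q n) z)"
    by (simp add: algebra_simps)
  then show ?case
    using Suc assms by simp
qed simp

text \<open>As polynomials in \<open>z\<close>, the recursion of \<open>rev_trunc\<close> turns
  \<open>x z\<close> times the \<open>n\<close>-th summand into the next summand minus
  \<open>coeff q (Suc n) * x ^ Suc n\<close>, so the sum telescopes. At a root \<open>x\<close> of
  \<open>q\<close>, once \<open>Suc L\<close> reaches the degree of \<open>q\<close>, the constant
  is 0 and a single reversed polynomial remains.\<close>

lemma rev_trunc_telescope:
  fixes q :: "'a::comm_ring_1 poly"
  shows "[:1, -x:] * (\<Sum>n\<le>L. smult (x ^ n) (rev_trunc q n))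
    = [:\<Sum>n\<le>Suc L. coeff q n * x ^ n:] - smult (x ^ Suc L) (rev_trunc q (Suc L))"
proof (induction L)
  case 0
  show ?case by (simp add: algebra_simps)
next
  case (Suc L)
  have "[:1, -x:] * (\<Sum>n\<le>Suc L. smult (x ^ n) (rev_trunc q n))
    = [:1, -x:] * (\<Sum>n\<le>L. smult (x ^ n) (rev_trunc q n))
      + [:1, -x:] * smult (x ^ Suc L) (rev_trunc q (Suc L))"
    by (simp only: sum.atMost_Suc distrib_left)
  also have "\<dots> = [:\<Sum>n\<le>Suc L. coeff q n * x ^ n:]
      - pCons 0 (smult (x ^ Suc (Suc L)) (rev_trunc q (Suc L)))"
    unfolding Suc
    by (rule poly_eqI)
      (simp add: coeff_pCons algebra_simps split: nat.splits del: sum.atMost_Suc rev_trunc.simps)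
  also have "\<dots> = [:\<Sum>n\<le>Suc (Suc L). coeff q n * x ^ n:]
      - smult (x ^ Suc (Suc L)) (rev_trunc q (Suc (Suc L)))"
    by (simp add: algebra_simps)
  finally show ?case .
qed

lemma rev_trunc_conv_sum:
  fixes q :: "'a::comm_semiring_1 poly"
  shows "rev_trunc q n = (\<Sum>i\<le>n. monom (coeff q i) (n - i))"
proof (induction n)
  case 0
  show ?case by (simp add: monom_0)
next
  case (Suc n)
  have "(\<Sum>i\<le>Suc n. monom (coeff q i) (Suc n - i))
     = monom (coeff q (Suc n)) 0 + (\<Sum>i\<le>n. pCons 0 (monom (coeff q i) (n - i)))"
    by (simp add: Suc_diff_le monom_Suc add.commute)
  also have "(\<Sum>i\<le>n. pCons 0 (monom (coeff q i) (n - i))) = pCons 0 (\<Sum>i\<le>n. monom (coeff q i) (n - i))"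
    by (rule poly_eqI) (simp add: coeff_pCons coeff_sum split: nat.splits)
  finally show ?case
    using Suc by (simp add: monom_0)
qed

section \<open>Order of vanishing at 0 and cancellation at a point\<close>

text \<open>The limit at 0 kills the constant coefficient; dividing by the argument then lowers
  \<open>N\<close> by one.\<close>

lemma coeff_eq_0_if_poly_uminus_bigo:
  fixes T :: "complex poly"
  assumes "(\<lambda>x. poly T (-x)) \<in> O[at 0](\<lambda>x. x ^ N)" and "n < N"
  shows "coeff T n = 0"
  using assms
proof (induction N arbitrary: T n)
  case (Suc N)
  obtain a T' where T: "T = pCons a T'" by (rule pCons_cases)
  obtain c where c: "\<forall>\<^sub>F x in at 0. norm (poly T (-x)) \<le> c * norm (x ^ Suc N)"
    by (rule landau_o.bigE[OF Suc.prems(1)])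
  have "((\<lambda>x. c * norm (x ^ Suc N)) \<longlongrightarrow> 0) (at (0::complex))"
    by (intro tendsto_mult_right_zero tendsto_norm_zero tendsto_null_power tendsto_ident_at) simp
  with c have "((\<lambda>x. poly T (-x)) \<longlongrightarrow> 0) (at 0)"
    by (rule Lim_null_comparison)
  moreover have "((\<lambda>x. poly T (-x)) \<longlongrightarrow> poly T (-0)) (at 0)"
    by (rule tendsto_poly[OF tendsto_minus[OF tendsto_ident_at]])
  ultimately have "0 = poly T (-0)"
    by (rule tendsto_unique[OF trivial_limit_at])
  then have a: "a = 0" by (simp add: T)
  have "\<forall>\<^sub>F x in at 0. norm (poly T' (-x)) \<le> c * norm (x ^ N)"
    using c eventually_neq_at_within[of 0 0 UNIV]
  proof eventually_elim
    case (elim x)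
    then have "norm x * norm (poly T' (-x)) \<le> norm x * (c * norm (x ^ N))"
      by (simp add: T a norm_mult mult_ac)
    then show ?case
      by (rule mult_left_le_imp_le) (use elim(2) in simp)
  qed
  then have "(\<lambda>x. poly T' (-x)) \<in> O[at 0](\<lambda>x. x ^ N)"
    by (rule bigoI)
  then have IH: "coeff T' k = 0" if "k < N" for k
    using that by (rule Suc.IH)
  show ?case
  proof (cases n)
    case 0
    then show ?thesis by (simp add: T a)
  next
    case (Suc k)
    then show ?thesis using IH[of k] Suc.prems(2) by (simp add: T)
  qed
next
  case 0
  then show ?case by (simp only: not_less0)
qed

text \<open>The smaller of the two orders at \<open>a\<close> is divided out. Cancelling at one
  point suffices, as poles are treated one at a time; the common exponent \<open>m\<close> keeps the
  degree count exact.\<close>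

lemma cancel_common_root:
  fixes P Q :: "'a::idom poly"
  assumes "P \<noteq> 0" "Q \<noteq> 0"
  obtains m P1 Q1 where "P = [:-a, 1:] ^ m * P1" "Q = [:-a, 1:] ^ m * Q1"
    "poly P1 a \<noteq> 0 \<or> poly Q1 a \<noteq> 0"
proof -
  obtain P' Q' where P': "P = [:-a, 1:] ^ order a P * P'" "poly P' a \<noteq> 0"
    and Q': "Q = [:-a, 1:] ^ order a Q * Q'" "poly Q' a \<noteq> 0"
    using order_decomp[OF assms(1), of a] order_decomp[OF assms(2), of a]
    unfolding poly_eq_0_iff_dvd by blast
  show ?thesis
  proof (cases "order a P \<le> order a Q")
    case True
    then have "Q = [:-a, 1:] ^ order a P * ([:-a, 1:] ^ (order a Q - order a P) * Q')"
      using Q'(1) by (simp flip: mult.assoc power_add)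
    with P' that show ?thesis by blast
  next
    case False
    then have "P = [:-a, 1:] ^ order a Q * ([:-a, 1:] ^ (order a P - order a Q) * P')"
      using P'(1) by (simp flip: mult.assoc power_add)
    with Q' that show ?thesis by blast
  qed
qed

lemma poly_conv_sum_atMost:
  fixes p :: "'a::comm_semiring_1 poly"
  assumes "degree p \<le> n"
  shows "poly p x = (\<Sum>i\<le>n. coeff p i * x ^ i)"
proof -
  have "(\<Sum>i\<le>degree p. coeff p i * x ^ i) = (\<Sum>i\<le>n. coeff p i * x ^ i)"
    using assms by (intro sum.mono_neutral_left) (auto simp: coeff_eq_0)
  then show ?thesis by (simp add: poly_altdef)
qed

section \<open>Integration of polynomials over the unit interval\<close>

locale unit_interval_measure = finite_measure \<mu> for \<mu> :: "real measure" +
  assumes sets_eq: "sets \<mu> = sets (restrict_space borel {0..1})"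
begin

lemma space_eq: "space \<mu> = {0..1}"
  using sets_eq_imp_space_eq[OF sets_eq] by (simp add: space_restrict_space)

lemma integrable_continuous_on:
  fixes g :: "real \<Rightarrow> 'b::{banach, second_countable_topology}"
  assumes "continuous_on {0..1} g"
  shows "integrable \<mu> g"
proof -
  have "g \<in> borel_measurable \<mu>"
    using borel_measurable_continuous_on_restrict[OF assms]
    by (simp add: measurable_cong_sets[OF sets_eq refl])
  moreover obtain B where "\<forall>z\<in>{0..1}. norm (g z) \<le> B"
    using compact_imp_bounded[OF compact_continuous_image[OF assms compact_Icc]]
    by (auto simp: bounded_iff)
  ultimately show ?thesis
    by (intro integrable_const_bound[of _ B]) (auto simp: space_eq)
qed

lemma integrable_poly: "integrable \<mu> (\<lambda>z. poly p (complex_of_real z))"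
  by (intro integrable_continuous_on continuous_intros)

lemma integrable_weighted_square: "integrable \<mu> (\<lambda>z. z ^ j * (norm (poly p (complex_of_real z)))\<^sup>2)"
  by (intro integrable_continuous_on continuous_intros)

lemma moment_functional_0 [simp]: "moment_functional \<mu> 0 = 0"
  by (simp add: moment_functional_def)

lemma moment_functional_add:
  "moment_functional \<mu> (p + q) = moment_functional \<mu> p + moment_functional \<mu> q"
  by (simp add: moment_functional_def integrable_poly)

lemma moment_functional_diff:
  "moment_functional \<mu> (p - q) = moment_functional \<mu> p - moment_functional \<mu> q"
  by (simp add: moment_functional_def integrable_poly)

lemma moment_functional_smult:
  "moment_functional \<mu> (smult c p) = c * moment_functional \<mu> p"
  by (simp add: moment_functional_def)

lemma moment_functional_sum:
  "moment_functional \<mu> (\<Sum>i\<in>A. p i) = (\<Sum>i\<in>A. moment_functional \<mu> (p i))"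
  by (induction A rule: infinite_finite_induct) (auto simp: moment_functional_add)

text \<open>At real points the conjugated polynomial takes conjugate values. This is how
  orthogonality is turned into positivity.\<close>

lemma moment_functional_square:
  "moment_functional \<mu> (monom 1 j * (q * map_poly cnj q))
     = of_real (LINT z|\<mu>. z ^ j * (norm (poly q (complex_of_real z)))\<^sup>2)"
  unfolding moment_functional_def
  by (simp flip: integral_complex_of_real complex_norm_square add: poly_monom)

lemma moment_functional_orthogonal:
  assumes "\<And>i. i < M \<Longrightarrow> moment_functional \<mu> (monom 1 i * E) = 0"
    and "degree h < M"
  shows "moment_functional \<mu> (h * E) = 0"
proof -
  have "h * E = (\<Sum>i\<le>degree h. monom (coeff h i) i) * E"
    by (simp only: poly_as_sum_of_monoms)
  also have "\<dots> = (\<Sum>i\<le>degree h. smult (coeff h i) (monom 1 i * E))"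
    by (simp add: sum_distrib_right smult_monom flip: mult_smult_left)
  finally have "moment_functional \<mu> (h * E)
      = moment_functional \<mu> (\<Sum>i\<le>degree h. smult (coeff h i) (monom 1 i * E))"
    by simp
  also have "\<dots> = 0"
    using assms by (simp add: moment_functional_sum moment_functional_smult)
  finally show ?thesis .
qed

section \<open>Location of the roots of the denominator\<close>

text \<open>The equation with \<open>b\<close> encodes both simplicity and the sign of the residue:
  its right-hand side is nonzero, hence so is \<open>poly Q1 (of_real t)\<close>, and it fixes the
  argument of \<open>poly P x\<close> relative to that value.\<close>

lemma pade_root:
  fixes P Q :: "complex poly"
  assumes degP: "degree P \<le> L" and degQ: "degree Q \<le> M" and MleL: "M \<le> Suc L"
    and moments: "\<And>n. n \<le> L + M \<Longrightarrow> moment_functional \<mu> (rev_trunc Q n) = coeff P n"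
    and x: "x \<noteq> 0" "poly Q x = 0" "poly P x \<noteq> 0"
  obtains t b :: real and Q1 where
    "0 < t" "t \<le> 1" "x = 1 / of_real t" "b > 0"
    "rev_trunc Q M = [:- of_real t, 1:] * Q1" "degree Q1 < M"
    "cnj (poly Q1 (of_real t)) * poly P x = x ^ L * of_real b"
    "t = 1 \<Longrightarrow> measure \<mu> {1} > 0 \<and> (AE z in \<mu>. z = 1 \<or> poly Q1 (of_real z) = 0 \<or> z = 0 \<and> M \<le> L)"
proof -
  define z0 where "z0 = 1 / x"
  define J where "J = Suc L - M"
  have z0: "z0 \<noteq> 0" "x * z0 = 1" using x by (auto simp: z0_def)
  have Q_sum: "(\<Sum>i\<le>n. coeff Q i * x ^ i) = 0" if "M \<le> n" for n
  proof -
    have "(\<Sum>i\<le>n. coeff Q i * x ^ i) = poly Q x"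
      using that degQ poly_conv_sum_atMost[of Q n x] by simp
    then show ?thesis using x by simp
  qed
  have "poly (rev_trunc Q M) z0 = 0"
    using poly_rev_trunc_inverse[OF z0(2), where n = M and q = Q] Q_sum[of M] x by simp
  then obtain Q1 where Q1: "rev_trunc Q M = [:-z0, 1:] * Q1"
    unfolding poly_eq_0_iff_dvd by blast
  have "poly P x = x ^ L * moment_functional \<mu> (monom 1 J * Q1)"
  proof -
    \<comment> \<open>The constant of the telescoped sum is \<open>poly Q x = 0\<close>, because
      \<open>M\<close> is at most \<open>Suc L\<close>. Below, \<open>1 - x z = -x (z - z0)\<close>
      cancels the linear factor of the reversed denominator and leaves \<open>Q1\<close>.\<close>
    have "[:1, -x:] * (\<Sum>n\<le>L. smult (x ^ n) (rev_trunc Q n)) = - smult (x ^ Suc L) (rev_trunc Q (M + J))"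
    proof -
      have "M + J = Suc L" using MleL by (simp add: J_def)
      then show ?thesis
        unfolding rev_trunc_telescope Q_sum[OF MleL] by simp
    qed
    also have "\<dots> = [:1, -x:] * smult (x ^ L) (monom 1 J * Q1)"
    proof -
      have "[:1, -x:] = smult (-x) [:-z0, 1:]" using z0 by simp
      moreover have "- smult (x ^ Suc L) (X * (D * Q1)) = smult (-x) D * smult (x ^ L) (X * Q1)" for X D
        by (simp add: algebra_simps)
      ultimately show ?thesis
        by (simp only: rev_trunc_add[OF degQ] Q1)
    qed
    finally have A: "(\<Sum>n\<le>L. smult (x ^ n) (rev_trunc Q n)) = smult (x ^ L) (monom 1 J * Q1)"
      by (subst (asm) mult_cancel_left) auto
    have "poly P x = (\<Sum>n\<le>L. coeff P n * x ^ n)"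
      using degP by (rule poly_conv_sum_atMost)
    also have "\<dots> = moment_functional \<mu> (\<Sum>n\<le>L. smult (x ^ n) (rev_trunc Q n))"
      by (simp add: moment_functional_sum moment_functional_smult moments mult.commute)
    finally show ?thesis by (simp add: A moment_functional_smult)
  qed
  note Px = this
  have "Q1 \<noteq> 0" using Px x by auto
  then have degQ1: "degree Q1 < M"
    using degree_rev_trunc[of Q M] by (simp add: Q1 degree_mult_eq del: mult_pCons_left)
  \<comment> \<open>For \<open>i < M\<close> the index \<open>M + i + J = L + 1 + i\<close> lies
    between \<open>L + 1\<close> and \<open>L + M\<close>: the moment equation still applies there,
    while the coefficient of \<open>P\<close> is already 0.\<close>
  have orth: "moment_functional \<mu> (h * (monom 1 J * ([:-z0, 1:] * Q1))) = 0" if "degree h < M" for h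
  proof (rule moment_functional_orthogonal[OF _ that])
    fix i assume "i < M"
    have "monom 1 i * (monom 1 J * ([:-z0, 1:] * Q1)) = rev_trunc Q (M + (i + J))"
      by (simp only: rev_trunc_add[OF degQ] Q1 mult.assoc[symmetric] mult_monom) simp
    then show "moment_functional \<mu> (monom 1 i * (monom 1 J * ([:-z0, 1:] * Q1))) = 0"
      using moments[of "M + (i + J)"] \<open>i < M\<close> MleL degP by (simp add: J_def coeff_eq_0)
  qed
  let ?N = "\<lambda>z. (norm (poly Q1 (complex_of_real z)))\<^sup>2"
  define a where "a = (LINT z|\<mu>. z ^ Suc J * ?N z)"
  define b where "b = (LINT z|\<mu>. z ^ J * ?N z)"
  \<comment> \<open>A vanishing weight would make the integral of \<open>z^J Q1\<close>, and with it
    \<open>poly P x\<close>, equal to 0.\<close>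
  have "b \<noteq> 0"
  proof
    assume "b = 0"
    then have "AE z in \<mu>. z ^ J * ?N z = 0"
      unfolding b_def
      by (subst (asm) integral_nonneg_eq_0_iff_AE) (auto simp: integrable_weighted_square space_eq)
    then have "AE z in \<mu>. poly (monom 1 J * Q1) (complex_of_real z) = 0"
      by eventually_elim (auto simp: poly_monom)
    then have "moment_functional \<mu> (monom 1 J * Q1) = 0"
      unfolding moment_functional_def by (rule integral_eq_zero_AE)
    then show False using Px x by simp
  qed
  moreover have "b \<ge> 0" unfolding b_def by (intro integral_nonneg_AE) (auto simp: space_eq)
  ultimately have b: "b > 0" by simp
  have a: "a \<ge> 0" unfolding a_def by (intro integral_nonneg_AE) (auto simp: space_eq)
  \<comment> \<open>A single integral with nonnegative integrand serves twice: for
    \<open>a / b\<close> being at most 1, and for the case of equality.\<close>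
  have "b - a = (LINT z|\<mu>. z ^ J * ?N z - z ^ Suc J * ?N z)"
    unfolding a_def b_def
    by (rule Bochner_Integration.integral_diff[symmetric]) (rule integrable_weighted_square)+
  also have "\<dots> = (LINT z|\<mu>. (1 - z) * (z ^ J * ?N z))"
    by (rule Bochner_Integration.integral_cong) (auto simp: algebra_simps)
  finally have ba: "b - a = (LINT z|\<mu>. (1 - z) * (z ^ J * ?N z))" .
  have ab: "a \<le> b"
  proof -
    have "b - a \<ge> 0" unfolding ba by (intro integral_nonneg_AE) (auto simp: space_eq)
    then show ?thesis by simp
  qed
  \<comment> \<open>Testing against the conjugate of \<open>Q1\<close> shows that \<open>z0\<close>
    is the weighted mean \<open>a / b\<close>, hence real.\<close>
  have "complex_of_real a = z0 * of_real b"
  proof -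
    have "degree (map_poly cnj Q1) < M"
      using degQ1 map_poly_degree_leq[of cnj Q1] by linarith
    moreover have "map_poly cnj Q1 * (monom 1 J * ([:-z0, 1:] * Q1))
      = monom 1 (Suc J) * (Q1 * map_poly cnj Q1) - smult z0 (monom 1 J * (Q1 * map_poly cnj Q1))"
      by (simp add: monom_Suc algebra_simps)
    ultimately show ?thesis
      using orth[of "map_poly cnj Q1"]
      by (simp add: moment_functional_diff moment_functional_smult moment_functional_square a_def b_def
          del: power_Suc)
  qed
  then have z0_eq: "z0 = of_real (a / b)" using b by (simp add: field_simps)
  define t where "t = a / b"
  have t: "0 < t" "t \<le> 1" 
    using a b ab z0(1) unfolding z0_eq t_def by (auto simp: less_le)
  have z0t: "z0 = of_real t" by (simp add: z0_eq t_def)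
  have "cnj (poly Q1 z0) * moment_functional \<mu> (monom 1 J * Q1) = of_real b"
  proof -
    \<comment> \<open>Since \<open>z0\<close> is real, the conjugated polynomial has the value
      \<open>cnj (poly Q1 z0)\<close> there. Orthogonality to the difference quotient
      \<open>Q3\<close> allows the conjugate of \<open>Q1\<close> to be replaced by this constant in
      the integral defining \<open>b\<close>.\<close>
    have "poly (map_poly cnj Q1 - [:cnj (poly Q1 z0):]) z0 = 0"
      by (simp add: z0t)
    then obtain Q3 where Q3: "map_poly cnj Q1 - [:cnj (poly Q1 z0):] = [:-z0, 1:] * Q3"
      unfolding poly_eq_0_iff_dvd by blast
    have "degree ([:-z0, 1:] * Q3) < M"
      unfolding Q3[symmetric] using degQ1 map_poly_degree_leq[of cnj Q1]
      by (intro degree_diff_less) auto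
    then have "degree Q3 < M"
      by (cases "Q3 = 0") (auto simp: degree_mult_eq simp del: mult_pCons_left)
    from orth[OF this] have "moment_functional \<mu> (([:-z0, 1:] * Q3) * (monom 1 J * Q1)) = 0"
      by (simp only: mult_ac)
    then have "moment_functional \<mu> (monom 1 J * (Q1 * map_poly cnj Q1) 
        - smult (cnj (poly Q1 z0)) (monom 1 J * Q1)) = 0"
      unfolding Q3[symmetric] by (simp add: algebra_simps)
    then show ?thesis
      by (simp add: moment_functional_diff moment_functional_smult moment_functional_square b_def)
  qed
  then have "cnj (poly Q1 (of_real t)) * poly P x = x ^ L * of_real b"
    unfolding Px z0t by (simp add: algebra_simps)
  moreover have "measure \<mu> {1} > 0 \<and> (AE z in \<mu>. z = 1 \<or> poly Q1 (of_real z) = 0 \<or> z = 0 \<and> M \<le> L)"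
    if "t = 1"
  proof -
    have "b - a = 0" using that b by (simp add: t_def)
    then have "AE z in \<mu>. (1 - z) * (z ^ J * ?N z) = 0"
      unfolding ba
      by (subst (asm) integral_nonneg_eq_0_iff_AE)
        (auto intro!: integrable_continuous_on continuous_intros simp: space_eq)
    then have AE: "AE z in \<mu>. z = 1 \<or> z ^ J * ?N z = 0"
      by eventually_elim auto
    have "measure \<mu> {1} \<noteq> 0"
    proof
      assume "measure \<mu> {1} = 0"
      moreover have "{1} \<in> sets \<mu>"
        unfolding sets_eq by (simp add: sets_restrict_space_iff)
      ultimately have "{1} \<in> null_sets \<mu>"
        by (simp add: null_sets_def emeasure_eq_measure)
      then have "AE z in \<mu>. z \<noteq> 1" using AE_not_in by fastforce
      with AE have "AE z in \<mu>. z ^ J * ?N z = 0" by eventually_elim auto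
      then have "b = 0" unfolding b_def by (rule integral_eq_zero_AE)
      with b show False by simp
    qed
    \<comment> \<open>The factor \<open>z ^ J\<close> vanishes only at 0 and only for
      \<open>J > 0\<close>, that is, for \<open>M\<close> at most \<open>L\<close>.\<close>
    moreover have "AE z in \<mu>. z = 1 \<or> poly Q1 (of_real z) = 0 \<or> z = 0 \<and> M \<le> L"
      using AE by eventually_elim (auto simp: J_def)
    ultimately show ?thesis by (simp add: zero_less_measure_iff)
  qed
  ultimately show ?thesis
    using that[of t b Q1] t b Q1 degQ1 by (simp add: z0t[symmetric] z0_def)
qed

section \<open>From accuracy through order to moment equations\<close>

text \<open>The remainder of the finite geometric sum is
  \<open>(- z \<xi>)^N / (1 + z \<xi>)\<close>, and its denominator has modulus at least 1/2 once
  \<open>\<xi>\<close> has modulus below 1/2.\<close>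

lemma stieltjes_function_expansion:
  "(\<lambda>\<xi>. stieltjes_function \<mu> \<xi> - (\<Sum>n<N. moment_functional \<mu> (monom 1 n) * (-\<xi>) ^ n))
     \<in> O[at 0](\<lambda>\<xi>. \<xi> ^ N)"
proof (rule bigoI)
  have "\<forall>\<^sub>F \<xi> in at 0. norm (\<xi>::complex) < 1 / 2"
    by (rule eventually_at_topological[THEN iffD2], rule exI[of _ "ball 0 (1/2)"]) auto
  then show "\<forall>\<^sub>F \<xi> in at 0. norm (stieltjes_function \<mu> \<xi> - (\<Sum>n<N. moment_functional \<mu> (monom 1 n) * (-\<xi>) ^ n))
       \<le> (2 * measure \<mu> (space \<mu>)) * norm (\<xi> ^ N)"
  proof eventually_elim
    fix \<xi> :: complex assume \<xi>: "norm \<xi> < 1 / 2"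
    have lower: "1 / 2 \<le> norm (1 + complex_of_real z * \<xi>)" if "z \<in> {0..1}" for z
    proof -
      have "norm (complex_of_real z * \<xi>) \<le> 1 * norm \<xi>"
        unfolding norm_mult using that by (intro mult_right_mono) auto
      then show ?thesis using \<xi> norm_diff_ineq[of 1 "complex_of_real z * \<xi>"] by simp
    qed
    have nz: "1 + complex_of_real z * \<xi> \<noteq> 0" if "z \<in> {0..1}" for z
      using lower[OF that] by auto
    let ?r = "\<lambda>z. 1 / (1 + complex_of_real z * \<xi>) - (\<Sum>n<N. of_real z ^ n * (-\<xi>) ^ n)"
    have r: "?r z = (- (of_real z * \<xi>)) ^ N / (1 + of_real z * \<xi>)" if "z \<in> {0..1}" for z
    proof -
      have "1 - (- (complex_of_real z * \<xi>)) ^ N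
        = (1 + of_real z * \<xi>) * (\<Sum>n<N. of_real z ^ n * (-\<xi>) ^ n)"
        using one_diff_power_eq[of "- (complex_of_real z * \<xi>)" N]
        by (simp flip: power_mult_distrib)
      then show ?thesis using nz[OF that] by (simp add: field_simps)
    qed
    have int: "integrable \<mu> (\<lambda>z. 1 / (1 + complex_of_real z * \<xi>))"
      using nz by (intro integrable_continuous_on continuous_intros) auto
    have ints: "integrable \<mu> (\<lambda>z. of_real z ^ n * (-\<xi>) ^ n)" for n
      by (intro integrable_continuous_on continuous_intros)
    have "stieltjes_function \<mu> \<xi> - (\<Sum>n<N. moment_functional \<mu> (monom 1 n) * (-\<xi>) ^ n) = (LINT z|\<mu>. ?r z)"
      using int ints by (simp add: stieltjes_function_def moment_functional_def poly_monom)
    also have "norm \<dots> \<le> (LINT z|\<mu>. 2 * norm (\<xi> ^ N))"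
    proof (rule Bochner_Integration.integral_norm_bound_integral)
      fix z assume "z \<in> space \<mu>"
      then have z: "z \<in> {0..1}" by (simp add: space_eq)
      have "norm (?r z) = norm (complex_of_real z * \<xi>) ^ N / norm (1 + of_real z * \<xi>)"
        by (simp add: r[OF z] norm_divide norm_power)
      also have "\<dots> \<le> norm \<xi> ^ N / (1 / 2)"
        using lower[OF z] z
        by (intro frac_le power_mono) (auto simp: norm_mult intro: mult_left_le_one_le)
      finally show "norm (?r z) \<le> 2 * norm (\<xi> ^ N)" by (simp add: norm_power)
    qed (use int ints in auto)
    finally show "norm (stieltjes_function \<mu> \<xi> - (\<Sum>n<N. moment_functional \<mu> (monom 1 n) * (-\<xi>) ^ n))
       \<le> (2 * measure \<mu> (space \<mu>)) * norm (\<xi> ^ N)"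
      by (simp add: mult_ac)
  qed
qed

text \<open>With \<open>T\<close> the Taylor polynomial of the function, multiplying the error by
  the bounded factor \<open>Q\<close> shows that \<open>T * Q - P\<close> vanishes to order
  \<open>N\<close>. The Cauchy product for its \<open>n\<close>-th coefficient is the moment
  functional at \<open>rev_trunc Q n\<close>.\<close>

lemma moments_of_bigo:
  fixes P Q :: "complex poly"
  assumes Q0: "coeff Q 0 \<noteq> 0"
    and bigo: "(\<lambda>\<xi>. stieltjes_function \<mu> \<xi> - poly P (-\<xi>) / poly Q (-\<xi>)) \<in> O[at 0](\<lambda>\<xi>. \<xi> ^ N)"
    and n: "n < N"
  shows "moment_functional \<mu> (rev_trunc Q n) = coeff P n"
proof -
  define T where "T = (\<Sum>n<N. monom (moment_functional \<mu> (monom 1 n)) n)"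
  have T: "poly T (-\<xi>) = (\<Sum>n<N. moment_functional \<mu> (monom 1 n) * (-\<xi>) ^ n)" for \<xi>
    by (simp add: T_def poly_sum poly_monom)
  have coeff_T: "coeff T k = moment_functional \<mu> (monom 1 k)" if "k < N" for k
    using that by (simp add: T_def coeff_sum)
  let ?f = "stieltjes_function \<mu>"
  have "((\<lambda>\<xi>. poly Q (-\<xi>)) \<longlongrightarrow> poly Q (-0)) (at 0)"
    by (intro tendsto_intros)
  then have Q_lim: "((\<lambda>\<xi>. poly Q (-\<xi>)) \<longlongrightarrow> coeff Q 0) (at 0)"
    by (simp add: poly_0_coeff_0)
  have "(\<lambda>\<xi>. (?f \<xi> - poly P (-\<xi>) / poly Q (-\<xi>)) - (?f \<xi> - poly T (-\<xi>))) \<in> O[at 0](\<lambda>\<xi>. \<xi> ^ N)"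
    using bigo stieltjes_function_expansion[of N] unfolding T by (rule sum_in_bigo)
  moreover have "(\<lambda>\<xi>. poly Q (-\<xi>)) \<in> O[at 0](\<lambda>_. 1)"
    by (rule bigoI_tendsto[of _ _ "coeff Q 0"]) (use Q_lim in auto)
  ultimately have "(\<lambda>\<xi>. ((?f \<xi> - poly P (-\<xi>) / poly Q (-\<xi>)) - (?f \<xi> - poly T (-\<xi>))) * poly Q (-\<xi>))
      \<in> O[at 0](\<lambda>\<xi>. \<xi> ^ N * 1)"
    by (rule landau_o.big.mult)
  moreover
  have "\<forall>\<^sub>F \<xi> in at 0. poly Q (-\<xi>) \<noteq> 0"
    using Q_lim Q0 by (rule tendsto_imp_eventually_ne)
  then have "\<forall>\<^sub>F \<xi> in at 0. ((?f \<xi> - poly P (-\<xi>) / poly Q (-\<xi>)) - (?f \<xi> - poly T (-\<xi>))) * poly Q (-\<xi>)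
      = poly (T * Q - P) (-\<xi>)"
    by eventually_elim (simp add: field_simps)
  note landau_o.big.in_cong[OF this]
  ultimately have "(\<lambda>\<xi>. poly (T * Q - P) (-\<xi>)) \<in> O[at 0](\<lambda>\<xi>. \<xi> ^ N)"
    by (simp only: mult_1_right)
  then have "coeff (Q * T - P) n = 0"
    using n by (metis coeff_eq_0_if_poly_uminus_bigo mult.commute)
  then have "coeff P n = (\<Sum>i\<le>n. coeff Q i * moment_functional \<mu> (monom 1 (n - i)))"
    using n by (simp add: coeff_mult coeff_T)
  also have "\<dots> = moment_functional \<mu> (\<Sum>i\<le>n. smult (coeff Q i) (monom 1 (n - i)))"
    by (simp add: moment_functional_sum moment_functional_smult)
  also have "(\<Sum>i\<le>n. smult (coeff Q i) (monom 1 (n - i))) = rev_trunc Q n"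
    by (simp add: rev_trunc_conv_sum smult_monom)
  finally show ?thesis by simp
qed

end


section \<open>Poles and residues of the approximant\<close>

lemma holomorphic_on_poly_compose [holomorphic_intros]:
  assumes "g holomorphic_on A"
  shows "(\<lambda>w. poly p (g w)) holomorphic_on A"
  unfolding poly_altdef using assms by (intro holomorphic_intros)

lemma borel_measure_on_unit_interval_iff:
  "borel_measure_on_unit_interval \<mu> \<longleftrightarrow> unit_interval_measure \<mu>"
  by (simp add: borel_measure_on_unit_interval_def unit_interval_measure_def
      unit_interval_measure_axioms_def)

theorem theorem2p3:
  fixes \<mu> :: "real measure" and L M :: nat and R :: "complex \<Rightarrow> complex" and p :: complex
  assumes "borel_measure_on_unit_interval \<mu>"
    and "int L - int M + 1 \<ge> 0"
    and "pade_approximant (stieltjes_function \<mu>) L M R"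
    and "is_pole R p"
  shows "zorder R p = -1 \<and>
         (\<exists>r::real. r > 0 \<and> residue R p = complex_of_real r) \<and>
         p \<in> complex_of_real ` {..-1} \<and>
         (\<not> degenerate_with_atom_at_one \<mu> L M \<longrightarrow> p \<in> complex_of_real ` {..<-1})"
proof -
  interpret unit_interval_measure \<mu>
    using assms(1) by (simp add: borel_measure_on_unit_interval_iff)
  have MleL: "M \<le> Suc L" using assms(2) by linarith
  obtain P0 Q0 where deg0: "degree P0 \<le> L" "degree Q0 \<le> M" and Q0_0: "coeff Q0 0 = 1"
    and R: "R = (\<lambda>\<xi>. poly P0 (-\<xi>) / poly Q0 (-\<xi>))"
    and bigo0: "(\<lambda>\<xi>. stieltjes_function \<mu> \<xi> - R \<xi>) \<in> O[at 0](\<lambda>\<xi>. \<xi> ^ (L + M + 1))"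
    using assms(3) unfolding pade_approximant_def by blast
  define x where "x = -p"
  have "P0 \<noteq> 0" using assms(4) unfolding R by auto
  moreover have "Q0 \<noteq> 0" using Q0_0 by auto
  ultimately obtain m P Q where PQ: "P0 = [:-x, 1:] ^ m * P" "Q0 = [:-x, 1:] ^ m * Q"
    and coprime: "poly P x \<noteq> 0 \<or> poly Q x \<noteq> 0"
    by (rule cancel_common_root)
  have nz: "P \<noteq> 0" "Q \<noteq> 0" using \<open>P0 \<noteq> 0\<close> \<open>Q0 \<noteq> 0\<close> PQ by auto
  have deg: "degree P + m \<le> L" "degree Q + m \<le> M"
    using deg0 nz by (simp_all add: PQ degree_mult_eq degree_linear_power)
  \<comment> \<open>At \<open>p\<close> itself the uncancelled quotient may be the junk value of a
    division by 0.\<close>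
  have R_eq: "R \<xi> = poly P (-\<xi>) / poly Q (-\<xi>)" if "\<xi> \<noteq> p" for \<xi>
    using that by (simp add: R PQ x_def)
  have "poly Q x = 0"
  proof (rule ccontr)
    assume "poly Q x \<noteq> 0"
    then have "((\<lambda>\<xi>. poly P (-\<xi>) / poly Q (-\<xi>)) \<longlongrightarrow> poly P x / poly Q x) (at p)"
      unfolding x_def by (intro tendsto_intros)
    then have "\<not> is_pole (\<lambda>\<xi>. poly P (-\<xi>) / poly Q (-\<xi>)) p"
      using not_tendsto_and_filterlim_at_infinity[of "at p"] by (auto simp: is_pole_def)
    moreover have "\<forall>\<^sub>F \<xi> in at p. R \<xi> = poly P (-\<xi>) / poly Q (-\<xi>)"
      using R_eq by (simp add: eventually_at_filter)
    ultimately show False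
      using assms(4) is_pole_cong[OF _ refl] by metis
  qed
  with coprime have Px: "poly P x \<noteq> 0" by simp
  have "poly Q0 0 = 1" using Q0_0 by (simp add: poly_0_coeff_0)
  \<comment> \<open>Cancellation may change the constant coefficient from 1, but it stays
    nonzero.\<close>
  then have Q_0: "poly Q 0 \<noteq> 0" by (auto simp: PQ)
  with \<open>poly Q x = 0\<close> have x: "x \<noteq> 0" by auto
  have "\<forall>\<^sub>F \<xi> in at 0. R \<xi> = poly P (-\<xi>) / poly Q (-\<xi>)"
    using eventually_neq_at_within[of p 0 UNIV] by eventually_elim (rule R_eq)
  then have "\<forall>\<^sub>F \<xi> in at 0. stieltjes_function \<mu> \<xi> - R \<xi>
      = stieltjes_function \<mu> \<xi> - poly P (-\<xi>) / poly Q (-\<xi>)"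
    by eventually_elim simp
  from landau_o.big.in_cong[OF this] bigo0
  have "(\<lambda>\<xi>. stieltjes_function \<mu> \<xi> - poly P (-\<xi>) / poly Q (-\<xi>))
      \<in> O[at 0](\<lambda>\<xi>. \<xi> ^ (L + M + 1))"
    by (rule iffD1)
  from moments_of_bigo[OF _ this] Q_0
  have moments: "moment_functional \<mu> (rev_trunc Q n) = coeff P n" if "n < L + M + 1" for n
    using that by (simp add: poly_0_coeff_0)
  \<comment> \<open>Cancelling lowers both degree bounds by \<open>m\<close>, which preserves their
    difference and hence the exponent \<open>J\<close>; the known order of accuracy is still the
    original \<open>L + M + 1\<close>.\<close>
  define L' M' where "L' = L - m" and "M' = M - m"
  have LM': "degree P \<le> L'" "degree Q \<le> M'" "M' \<le> Suc L'" "L' + M' < L + M + 1"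
    "M' \<le> L' \<longleftrightarrow> M \<le> L" "M' \<le> M"
    using deg MleL by (auto simp: L'_def M'_def)
  obtain t b :: real and Q1 where t: "0 < t" "t \<le> 1" "x = 1 / of_real t" and "b > 0"
    and Q1: "rev_trunc Q M' = [:- of_real t, 1:] * Q1" "degree Q1 < M'"
    and eq: "cnj (poly Q1 (of_real t)) * poly P x = x ^ L' * of_real b"
    and degenerate: "t = 1 \<Longrightarrow> measure \<mu> {1} > 0 \<and>
      (AE z in \<mu>. z = 1 \<or> poly Q1 (of_real z) = 0 \<or> z = 0 \<and> M' \<le> L')"
    by (rule pade_root[OF LM'(1,2,3) moments x \<open>poly Q x = 0\<close> Px]) (use LM'(4) in auto)
  have Q1t: "poly Q1 (of_real t) \<noteq> 0"
    using eq x \<open>b > 0\<close> by auto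
  have "p = - x" by (simp add: x_def)
  then have p: "p = of_real (- 1 / t)" by (simp add: t(3))
  have recip: "- (1 / p) = of_real t" using t by (simp add: p)
  \<comment> \<open>The set where both 0 and the zeros of the remaining factor of the denominator
    are avoided.\<close>
  define S where "S = - {0} \<inter> (\<lambda>\<xi>. poly Q1 (- (1 / \<xi>))) -` (- {0})"
  txt \<open>\<open>G\<close> is \<open>(\<xi> - p) R(\<xi>)\<close>, the zero of the denominator at \<open>p\<close> being cancelled via
    \<open>1 + t \<xi> = t (\<xi> - p)\<close>.\<close>
  define G where "G = (\<lambda>\<xi>. poly P (-\<xi>) / ((-\<xi>) ^ (M' - 1) * of_real t * poly Q1 (- (1 / \<xi>))))"
  have "open S"
    unfolding S_def by (intro continuous_open_preimage continuous_intros) auto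
  have "p \<in> S"
    using Q1t x by (simp add: S_def recip x_def)
  have "G holomorphic_on S"
    unfolding G_def S_def using t by (intro holomorphic_intros) auto
  have R_G: "R \<xi> = G \<xi> / (\<xi> - p)" if "\<xi> \<in> S" "\<xi> \<noteq> p" for \<xi>
  proof -
    have \<xi>: "\<xi> \<noteq> 0" using that by (simp add: S_def)
    have "poly Q (-\<xi>) = (-\<xi>) ^ M' * poly (rev_trunc Q M') (- (1 / \<xi>))"
      using poly_rev_trunc_inverse[where x = "-\<xi>" and z = "- (1 / \<xi>)" and n = M' and q = Q] \<xi>
        poly_conv_sum_atMost[OF LM'(2), of "-\<xi>"] by simp
    \<comment> \<open>\<open>M'\<close> is positive because it exceeds \<open>degree Q1\<close>; the
      factor split off turns \<open>-1/\<xi> - t\<close> into \<open>1 + t \<xi>\<close>.\<close>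
    also have "(-\<xi>) ^ M' = (-\<xi>) ^ (M' - 1) * (-\<xi>)"
      using Q1(2) by (cases M') auto
    also have "(-\<xi>) ^ (M' - 1) * (-\<xi>) * poly (rev_trunc Q M') (- (1 / \<xi>))
       = (-\<xi>) ^ (M' - 1) * poly Q1 (- (1 / \<xi>)) * (1 + of_real t * \<xi>)"
      using \<xi> by (simp add: Q1 field_simps)
    also have "1 + of_real t * \<xi> = of_real t * (\<xi> - p)"
      using t by (simp add: p field_simps)
    finally show ?thesis
      using that by (simp add: R_eq G_def)
  qed
  \<comment> \<open>The numerator is a positive multiple of \<open>poly Q1 (of_real t)\<close>, so
    this value cancels against the denominator; what remains is positive because
    \<open>x = 1 / t\<close> is.\<close>
  have "G p = of_real ((1 / t) ^ L' * b / ((1 / t) ^ (M' - 1) * t * (norm (poly Q1 (of_real t)))\<^sup>2))"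
  proof -
    have "poly P x = x ^ L' * of_real b * poly Q1 (of_real t) / of_real ((norm (poly Q1 (of_real t)))\<^sup>2)"
      using eq Q1t by (simp add: complex_norm_square field_simps del: of_real_power)
    moreover have "G p = poly P x / (x ^ (M' - 1) * of_real t * poly Q1 (of_real t))"
      unfolding G_def by (simp only: recip x_def)
    ultimately show ?thesis
      using Q1t t by simp
  qed
  moreover define r where "r = (1 / t) ^ L' * b / ((1 / t) ^ (M' - 1) * t * (norm (poly Q1 (of_real t)))\<^sup>2)"
  ultimately have Gp: "G p = of_real r" by simp
  have "r > 0" unfolding r_def using t \<open>b > 0\<close> Q1t by simp
  have "zorder R p = -1"
    using \<open>open S\<close> \<open>p \<in> S\<close> \<open>G holomorphic_on S\<close>
  proof (rule zorder_eqI)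
    show "G p \<noteq> 0" using Gp \<open>r > 0\<close> by simp
    show "R w = G w * (w - p) powi -1" if "w \<in> S" "w \<noteq> p" for w
      using R_G[OF that] by (simp add: power_int_minus field_simps)
  qed
  moreover have "residue R p = of_real r"
  proof -
    have "\<forall>\<^sub>F w in at p. w \<in> S - {p}"
      using \<open>open S\<close> \<open>p \<in> S\<close> by (rule eventually_at_in_open)
    then have "\<forall>\<^sub>F w in at p. R w = G w / (w - p)"
      by eventually_elim (simp add: R_G)
    then have "residue R p = residue (\<lambda>w. G w / (w - p)) p"
      by (rule residue_cong) simp
    then show ?thesis
      using residue_simple[OF \<open>open S\<close> \<open>p \<in> S\<close> \<open>G holomorphic_on S\<close>] Gp by simp
  qed
  moreover have "p \<in> complex_of_real ` {..-1}"
    unfolding p using t by (intro imageI) (simp add: field_simps)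
  moreover have "p \<in> complex_of_real ` {..<-1}" if "\<not> degenerate_with_atom_at_one \<mu> L M"
  proof -
    have "t \<noteq> 1"
    proof
      assume "t = 1"
      note deg1 = degenerate[OF this]
      \<comment> \<open>The real roots of \<open>Q1\<close> together with 1 number at most
        \<open>degree Q1 + 1\<close>, hence at most \<open>M\<close>, and carry the measure up to a
        possible atom at 0.\<close>
      define Z where "Z = {z::real. poly Q1 (of_real z) = 0}"
      have "Q1 \<noteq> 0" using Q1t by auto
      then have Z: "card (complex_of_real ` Z) \<le> degree Q1" "finite (complex_of_real ` Z)"
        using card_mono[of "{z. poly Q1 z = 0}" "complex_of_real ` Z"] card_poly_roots_bound[of Q1]
          poly_roots_finite[of Q1] finite_subset[of "complex_of_real ` Z" "{z. poly Q1 z = 0}"]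
        by (auto simp: Z_def image_subset_iff)
      have "inj_on complex_of_real Z" by (simp add: inj_on_def)
      with Z have "card Z \<le> degree Q1" "finite Z"
        by (auto simp: card_image dest: finite_imageD)
      then have "finite (insert 1 Z)" "card (insert 1 Z) \<le> M"
        using Q1(2) LM'(6) card_insert_le_m1[of M Z 1] by (auto simp: card_insert_if)
      moreover have "AE z in \<mu>. z \<in> insert 1 Z \<or> (z = 0 \<and> M \<le> L)"
        using deg1[THEN conjunct2] by eventually_elim (auto simp: Z_def LM'(5))
      ultimately have "degenerate_with_atom_at_one \<mu> L M"
        using deg1 unfolding degenerate_with_atom_at_one_def by blast
      with that show False by simp
    qed
    then show ?thesis
      unfolding p using t by (intro imageI) (simp add: field_simps)
  qed
  ultimately show ?thesis using \<open>r > 0\<close> by blast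
qed

end
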